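(* Let $n,k,d$ be positive integers with $k<n$. Let $Net$ be a neural network of the form $Net = Net_1\circ f_1$, where $f_1:\mathbb{R}^n\to\mathbb{R}^k$ is given by $f_1(x)=\sigma(W(x)+b)$, with $W$ a $k\times n$ real matrix, $b\in\mathbb{R}^k$ and $\sigma:\mathbb{R}\to\mathbb{R}$ an activation function applied coordinate-wise, and where $Net_1:\mathbb{R}^k\to\mathbb{R}^d$ is an arbitrary neural network. Then there exists topologically labeled data $(D,h,g)$, with $h:D\to\mathcal{D}\subset\mathbb{R}^n$, $\mathcal{D}=h(D)$, and $g:\mathcal{D}_L\to\mathcal{Y}$ for some closed $\mathcal{D}_L\subset\mathcal{D}$ and some finite label set $\mathcal{Y}$, that is not separated by $Net$.
   Context: A neural network is a finite composition $f_L\circ\cdots\circ f_1:\mathbb{R}^{d_{in}}\to\mathbb{R}^{d_{out}}$ of layer functions. A layer function $f_i:\mathbb{R}^{n_i}\to\mathbb{R}^{m_i}$ is a continuous, piecewise smooth function, typically of the form $f_i(x)=\sigma(W_i(x)+b_i)$ with $W_i$ an $m_i\times n_i$ matrix, $b_i\in\mathbb{R}^{m_i}$, and $\sigma:\mathbb{R}\to\mathbb{R}$ a nonlinear function applied coordinate-wise. Topological data with ambient space $E$ is a pair $(D,h)$ where $D = M_1 \sqcup \cdots \sqcup M_r$ is a disjoint union of finitely many compact manifolds (possibly of different dimensions, boundary allowed) and $h: D \to E$ is continuous; write $\mathcal{D}=h(D)\subset E$. Let $\mathcal{Y}=\{l_1,\dots,l_m\}$ be a finite set of $m$ distinct labels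 with the discrete topology. A topological labeling on $\mathcal{D}$ is a closed subset $\mathcal{D}_L\subset\mathcal{D}$ together with a surjective continuous function $g:\mathcal{D}_L\to\mathcal{Y}$. The triple $(D,h,g)$ is then called topologically labeled data. Write $\mathcal{D}_i=g^{-1}(l_i)$ for $1\le i\le m$. For topologically labeled data with ambient space $E=\mathbb{R}^{n}$, a continuous function $f:\mathbb{R}^{n}\to\mathbb{R}^d$ separates $(D,h,g)$ if there exist $m=|\mathcal{Y}|$ pairwise disjoint embedded $d$-dimensional discs $A_1,\dots,A_m$ in $\mathbb{R}^d$ such that $f(\mathcal{D}_i)\subset A_i$ for every $1\le i\le m$. An embedded $d$-dimensional disc in $\mathbb{R}^d$ is the image of the closed unit ball of $\mathbb{R}^d$ under a topological embedding into $\mathbb{R}^d$. *)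

theory Defs
  imports "HOL-Analysis.Analysis"
begin

text \<open>
  Throughout, $\mathbb{R}^n$ is the library topology \<^const>\<open>Euclidean_space\<close> \<open>n\<close>: its points are the
  sequences \<open>x :: nat \<Rightarrow> real\<close> with \<open>x i = 0\<close> for \<open>i \<ge> n\<close>. A map between Euclidean spaces is a
  function on sequences, of which only the values on the source space are relevant.
\<close>

section \<open>Piecewise smooth maps\<close>

text \<open>
  \<open>C_on n U r g\<close>: the real-valued function \<open>g\<close> is of class $C^r$ on the open subset \<open>U\<close> of
  $\mathbb{R}^n$, expressed by continuous iterated partial derivatives.
\<close>

primrec C_on :: "nat \<Rightarrow> (nat \<Rightarrow> real) set \<Rightarrow> nat \<Rightarrow> ((nat \<Rightarrow> real) \<Rightarrow> real) \<Rightarrow> bool" where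
  "C_on n U 0 g \<longleftrightarrow> continuous_map (subtopology (Euclidean_space n) U) euclideanreal g"
| "C_on n U (Suc r) g \<longleftrightarrow>
     continuous_map (subtopology (Euclidean_space n) U) euclideanreal g \<and>
     (\<forall>i<n. \<exists>g'. (\<forall>x\<in>U. ((\<lambda>t. g (x(i := t))) has_real_derivative g' x) (at (x i))) \<and>
                 C_on n U r g')"

definition smooth_map_on ::
    "nat \<Rightarrow> nat \<Rightarrow> (nat \<Rightarrow> real) set \<Rightarrow> ((nat \<Rightarrow> real) \<Rightarrow> (nat \<Rightarrow> real)) \<Rightarrow> bool" where
  "smooth_map_on n m U f \<longleftrightarrow>
     openin (Euclidean_space n) U \<and>
     f ` U \<subseteq> topspace (Euclidean_space m) \<and>
     (\<forall>i<m. \<forall>r. C_on n U r (\<lambda>x. f x i))"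

text \<open>
  The space is covered by a locally finite family of closed pieces, and the map is smooth on every
  piece, i.e. on the piece it agrees with a smooth map defined on an open neighbourhood of it.
\<close>

definition piecewise_smooth :: "nat \<Rightarrow> nat \<Rightarrow> ((nat \<Rightarrow> real) \<Rightarrow> (nat \<Rightarrow> real)) \<Rightarrow> bool" where
  "piecewise_smooth n m f \<longleftrightarrow>
     (\<exists>\<P>. locally_finite_in (Euclidean_space n) \<P> \<and>
          \<Union>\<P> = topspace (Euclidean_space n) \<and>
          (\<forall>P\<in>\<P>. closedin (Euclidean_space n) P \<and>
             (\<exists>U g. P \<subseteq> U \<and> smooth_map_on n m U g \<and> (\<forall>x\<in>P. f x = g x))))"

section \<open>Neural networks\<close>

definition layer_function :: "nat \<Rightarrow> nat \<Rightarrow> ((nat \<Rightarrow> real) \<Rightarrow> (nat \<Rightarrow> real)) \<Rightarrow> bool" where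
  "layer_function n m f \<longleftrightarrow>
     continuous_map (Euclidean_space n) (Euclidean_space m) f \<and> piecewise_smooth n m f"

inductive neural_network :: "nat \<Rightarrow> nat \<Rightarrow> ((nat \<Rightarrow> real) \<Rightarrow> (nat \<Rightarrow> real)) \<Rightarrow> bool" where
  layer: "layer_function n m f \<Longrightarrow> neural_network n m f"
| compose: "neural_network n m f \<Longrightarrow> layer_function m p g \<Longrightarrow> neural_network n p (g \<circ> f)"

definition activation_function :: "(real \<Rightarrow> real) \<Rightarrow> bool" where
  "activation_function \<sigma> \<longleftrightarrow> \<not> linear \<sigma>"

text \<open>
  The map $x \mapsto \sigma(Wx + b)$ from $\mathbb{R}^n$ to $\mathbb{R}^k$, with \<open>\<sigma>\<close> applied
  coordinate-wise. Only the entries \<open>W i j\<close> and \<open>b i\<close> with \<open>i < k\<close> and \<open>j < n\<close> are used.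
\<close>

definition dense_layer ::
    "nat \<Rightarrow> nat \<Rightarrow> (real \<Rightarrow> real) \<Rightarrow> (nat \<Rightarrow> nat \<Rightarrow> real) \<Rightarrow> (nat \<Rightarrow> real) \<Rightarrow> (nat \<Rightarrow> real) \<Rightarrow> (nat \<Rightarrow> real)"
  where
  "dense_layer n k \<sigma> W b x = (\<lambda>i. if i < k then \<sigma> ((\<Sum>j<n. W i j * x j) + b i) else 0)"

section \<open>Topologically labeled data\<close>

text \<open>
  For \<open>p = 0\<close> this is all of $\mathbb{R}^0$, because \<open>x 0 = 0\<close> there.
\<close>

definition Euclidean_half_space :: "nat \<Rightarrow> (nat \<Rightarrow> real) topology" where
  "Euclidean_half_space p = subtopology (Euclidean_space p) {x. 0 \<le> x 0}"

text \<open>Compact topological \<open>p\<close>-manifolds, possibly with boundary.\<close>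

definition compact_manifold :: "nat \<Rightarrow> 'a topology \<Rightarrow> bool" where
  "compact_manifold p M \<longleftrightarrow>
     compact_space M \<and> Hausdorff_space M \<and> second_countable M \<and>
     (\<forall>x\<in>topspace M. \<exists>U V. openin M U \<and> x \<in> U \<and> openin (Euclidean_half_space p) V \<and>
        subtopology M U homeomorphic_space subtopology (Euclidean_half_space p) V)"

definition topological_data ::
    "'e topology \<Rightarrow> (nat \<times> 'a) topology \<Rightarrow> (nat \<times> 'a \<Rightarrow> 'e) \<Rightarrow> bool" where
  "topological_data E D h \<longleftrightarrow>
     (\<exists>r M. (\<forall>i\<in>{1..r}. \<exists>p. compact_manifold p (M i)) \<and> D = sum_topology M {1..r}) \<and>
     continuous_map D E h"

definition topological_labeling ::
    "'e topology \<Rightarrow> 'e set \<Rightarrow> 'e set \<Rightarrow> 'l set \<Rightarrow> ('e \<Rightarrow> 'l) \<Rightarrow> bool" where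
  "topological_labeling E S S\<^sub>L Y g \<longleftrightarrow>
     finite Y \<and>
     closedin (subtopology E S) S\<^sub>L \<and>
     continuous_map (subtopology E S\<^sub>L) (discrete_topology Y) g \<and>
     g ` S\<^sub>L = Y"

text \<open>The domain \<open>S\<^sub>L\<close> of the labeling \<open>g\<close> and its label set \<open>Y\<close> are explicit arguments.\<close>

definition topologically_labeled_data ::
    "'e topology \<Rightarrow> (nat \<times> 'a) topology \<Rightarrow> (nat \<times> 'a \<Rightarrow> 'e) \<Rightarrow> 'e set \<Rightarrow> 'l set \<Rightarrow> ('e \<Rightarrow> 'l) \<Rightarrow> bool"
  where
  "topologically_labeled_data E D h S\<^sub>L Y g \<longleftrightarrow>
     topological_data E D h \<and> topological_labeling E (h ` topspace D) S\<^sub>L Y g"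

section \<open>Separation\<close>

definition closed_unit_ball :: "nat \<Rightarrow> (nat \<Rightarrow> real) topology" where
  "closed_unit_ball d = subtopology (Euclidean_space d) {x. (\<Sum>i<d. (x i)\<^sup>2) \<le> 1}"

definition embedded_disc :: "nat \<Rightarrow> (nat \<Rightarrow> real) set \<Rightarrow> bool" where
  "embedded_disc d A \<longleftrightarrow>
     (\<exists>\<phi>. embedding_map (closed_unit_ball d) (Euclidean_space d) \<phi> \<and>
          A = \<phi> ` topspace (closed_unit_ball d))"

text \<open>
  The sets $\mathcal{D}_i = g^{-1}(l_i)$ depend only on the labeling, so \<open>D\<close> and \<open>h\<close> do not occur.
  Continuity of \<open>f\<close> is a standing assumption on the maps to which this is applied.
\<close>

definition separates ::
    "nat \<Rightarrow> ('e \<Rightarrow> (nat \<Rightarrow> real)) \<Rightarrow> 'e set \<Rightarrow> 'l set \<Rightarrow> ('e \<Rightarrow> 'l) \<Rightarrow> bool" where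
  "separates d f S\<^sub>L Y g \<longleftrightarrow>
     (\<exists>A. (\<forall>l\<in>Y. embedded_disc d (A l)) \<and> disjoint_family_on A Y \<and>
          (\<forall>l\<in>Y. f ` {x \<in> S\<^sub>L. g x = l} \<subseteq> A l))"

end

theory Submission
  imports Defs
begin

text \<open>
  Since \<open>k < n\<close>, the matrix \<open>W\<close> kills some non-zero vector \<open>v\<close>, so \<open>f\<^sub>1\<close> and hence \<open>Net\<close> identify
  the points \<open>0\<close> and \<open>v\<close>. A map identifying two points cannot separate the two-point data that gives
  them different labels: their common image would lie in two disjoint discs.
\<close>

text \<open>Gaussian elimination, by induction on the set of equations. Each step removes one
  equation together with one unknown, or just an equation that is trivial. Arbitrary index sets
  spare a renumbering of the remaining rows and columns.\<close>

lemma exists_nontrivial_solution: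
  fixes A :: "'i \<Rightarrow> 'j \<Rightarrow> 'f::field"
  assumes "finite I" "card I < card J"
  shows "\<exists>v. (\<exists>j\<in>J. v j \<noteq> 0) \<and> (\<forall>i\<in>I. (\<Sum>j\<in>J. A i j * v j) = 0)"
  using assms
proof (induction I arbitrary: A J rule: finite_induct)
  case empty
  then obtain j where "j \<in> J"
    by (metis card.empty card_gt_0_iff ex_in_conv)
  then show ?case
    by (intro exI[of _ "\<lambda>_. 1"]) auto
next
  case (insert a I)
  have J: "finite J"
    using insert.prems by (metis card.infinite not_less0)
  show ?case
  proof (cases "\<forall>j\<in>J. A a j = 0")
    case True
    have "card I < card J"
      using insert.prems insert.hyps by simp
    with insert.IH[of J A] True show ?thesis
      by auto
  next
    case False
    then obtain p where p: "p \<in> J" "A a p \<noteq> 0"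
      by blast
    define K where "K = J - {p}"
    have K: "finite K" "p \<notin> K" "J = insert p K"
      using J p by (auto simp: K_def)
    have "card I < card K"
      using insert.prems insert.hyps K by simp
    \<comment> \<open>Subtracting \<open>A i p / A a p\<close> times row \<open>a\<close> from row
      \<open>i\<close> cancels the unknown \<open>p\<close>. The reduced system is the Schur
      complement of the pivot \<open>A a p\<close>.\<close>
    then obtain w where w: "\<exists>j\<in>K. w j \<noteq> 0"
      and w0: "\<And>i. i \<in> I \<Longrightarrow> (\<Sum>j\<in>K. (A i j - A i p * A a j / A a p) * w j) = 0"
      using insert.IH[of K "\<lambda>i j. A i j - A i p * A a j / A a p"] by blast
    \<comment> \<open>The value at \<open>p\<close> is the one that equation \<open>a\<close> forces
      once the other unknowns are given by \<open>w\<close>.\<close>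
    define v where "v = w(p := - (\<Sum>j\<in>K. A a j * w j) / A a p)"
    \<comment> \<open>For \<open>i = a\<close> the pivot cancels and the right-hand side vanishes;
      for \<open>i\<close> in \<open>I\<close> it is the left-hand side of the reduced equation
      \<open>w0\<close>.\<close>
    have v: "(\<Sum>j\<in>J. A i j * v j) =
        (\<Sum>j\<in>K. A i j * w j) - A i p * (\<Sum>j\<in>K. A a j * w j) / A a p" for i
    proof -
      have "(\<Sum>j\<in>K. A i j * v j) = (\<Sum>j\<in>K. A i j * w j)"
        using K by (intro sum.cong) (auto simp: v_def)
      then show ?thesis
        using K by (simp add: v_def)
    qed
    have "(\<Sum>j\<in>J. A i j * v j) = 0" if "i \<in> insert a I" for i
    proof (cases "i = a")
      case True
      with p show ?thesis
        by (simp add: v)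
    next
      case False
      with that have "i \<in> I"
        by simp
      from w0[OF this] show ?thesis
        by (simp add: v left_diff_distrib sum_subtractf sum_distrib_left sum_divide_distrib
            mult.assoc)
    qed
    moreover have "\<exists>j\<in>J. v j \<noteq> 0"
      using w K by (auto simp: v_def)
    ultimately show ?thesis
      by blast
  qed
qed

lemma Euclidean_space_0: "Euclidean_space 0 = discrete_topology {\<lambda>_. 0}"
  by (intro finite_topspace_imp_discrete_topology)
    (auto simp: topspace_Euclidean_space Hausdorff_Euclidean_space)

text \<open>Provides the two components of the two-point data. A one-point space is its own chart,
  since the half-space condition is vacuous in dimension 0.\<close>

lemma compact_manifold_Euclidean_space_0: "compact_manifold 0 (Euclidean_space 0)"
proof -
  have half: "Euclidean_half_space 0 = Euclidean_space 0"
    unfolding Euclidean_half_space_def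
    by (metis (mono_tags, lifting) Euclidean_space_0 empty_subsetI insert_subset mem_Collect_eq
        order_refl subtopology_superset topspace_discrete_topology)
  have "second_countable (Euclidean_space 0)"
    by (simp add: Euclidean_space_0 second_countable_discrete_topology)
  moreover have "compact_space (Euclidean_space 0)"
    by (simp add: Euclidean_space_0 compact_space_discrete_topology)
  ultimately show ?thesis
    unfolding compact_manifold_def half
    using Hausdorff_Euclidean_space openin_topspace homeomorphic_space_refl by blast
qed

lemma not_separating_if_not_injective:
  fixes x y :: 'e and f :: "'e \<Rightarrow> nat \<Rightarrow> real"
  assumes "Hausdorff_space E" "x \<in> topspace E" "y \<in> topspace E" "x \<noteq> y" "f x = f y"
  shows "\<exists>(D :: (nat \<times> (nat \<Rightarrow> real)) topology) h S\<^sub>L (Y :: nat set) g.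
           topologically_labeled_data E D h S\<^sub>L Y g \<and> \<not> separates d f S\<^sub>L Y g"
proof -
  define D :: "(nat \<times> (nat \<Rightarrow> real)) topology"
    where "D = sum_topology (\<lambda>_. Euclidean_space 0) {1..2}"
  \<comment> \<open>Points of \<open>D\<close> are pairs of a component index and the single point
    of that component; index 1 goes to \<open>x\<close> and index 2 to \<open>y\<close>.\<close>
  define h :: "nat \<times> (nat \<Rightarrow> real) \<Rightarrow> 'e" where "h = (\<lambda>p. if fst p = 1 then x else y)"
  define Y :: "nat set" where "Y = {0, 1}"
  define g :: "'e \<Rightarrow> nat" where "g = (\<lambda>z. if z = x then 0 else 1)"
  have discrete: "D = discrete_topology ({1..2} \<times> {\<lambda>_. 0})"
    unfolding D_def Euclidean_space_0
    by (auto simp: topology_eq openin_sum_topology)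
  then have "continuous_map D E h"
    using assms by (auto simp: h_def)
  moreover have "\<exists>r M. (\<forall>i\<in>{1..r}. \<exists>p. compact_manifold p (M i)) \<and> D = sum_topology M {1..r}"
    using compact_manifold_Euclidean_space_0
    by (intro exI[of _ 2] exI[of _ "\<lambda>_. Euclidean_space 0"]) (auto simp: D_def)
  ultimately have data: "topological_data E D h"
    by (simp add: topological_data_def)
  have "{1..2::nat} = {1, 2}"
    by auto
  with discrete have hD: "h ` topspace D = {x, y}"
    by (auto simp: h_def)
  \<comment> \<open>A finite subspace of a Hausdorff space is discrete, so labeling \<open>x\<close>
    and \<open>y\<close> differently is continuous.\<close>
  have "subtopology E {x, y} = discrete_topology {x, y}"
    using assms by (intro subtopology_eq_discrete_topology_finite) (auto simp: Hausdorff_imp_t1_space)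
  then have "topological_labeling E (h ` topspace D) {x, y} Y g"
    using assms unfolding topological_labeling_def hD by (auto simp: Y_def g_def)
  with data have "topologically_labeled_data E D h {x, y} Y g"
    by (simp add: topologically_labeled_data_def)
  moreover have "\<not> separates d f {x, y} Y g"
  proof
    assume "separates d f {x, y} Y g"
    then obtain A where A: "disjoint_family_on A Y"
      "\<And>l. l \<in> Y \<Longrightarrow> f ` {z \<in> {x, y}. g z = l} \<subseteq> A l"
      unfolding separates_def by blast
    have "f x \<in> A 0"
      using A(2)[of 0] by (auto simp: Y_def g_def)
    moreover have "f y \<in> A 1"
      using A(2)[of 1] \<open>x \<noteq> y\<close> by (auto simp: Y_def g_def)
    moreover have "A 0 \<inter> A 1 = {}"
      using A(1) by (simp add: Y_def disjoint_family_on_def)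
    ultimately show False
      using \<open>f x = f y\<close> by auto
  qed
  ultimately show ?thesis
    by blast
qed

theorem theorem7p1:
  fixes n k d :: nat
    and W :: "nat \<Rightarrow> nat \<Rightarrow> real"
    and b :: "nat \<Rightarrow> real"
    and \<sigma> :: "real \<Rightarrow> real"
    and f\<^sub>1 Net\<^sub>1 Net :: "(nat \<Rightarrow> real) \<Rightarrow> (nat \<Rightarrow> real)"
  assumes "0 < n" and "0 < k" and "0 < d" and "k < n"
    and "activation_function \<sigma>"
    and "f\<^sub>1 = dense_layer n k \<sigma> W b"
    and "layer_function n k f\<^sub>1"
    and "neural_network k d Net\<^sub>1"
    and "Net = Net\<^sub>1 \<circ> f\<^sub>1"
  shows "\<exists>(D :: (nat \<times> (nat \<Rightarrow> real)) topology) (h :: nat \<times> (nat \<Rightarrow> real) \<Rightarrow> (nat \<Rightarrow> real))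
            (D\<^sub>L :: (nat \<Rightarrow> real) set) (Y :: nat set) (g :: (nat \<Rightarrow> real) \<Rightarrow> nat).
           topologically_labeled_data (Euclidean_space n) D h D\<^sub>L Y g \<and>
           \<not> separates d Net D\<^sub>L Y g"
proof -
  obtain v where v: "\<exists>j<n. v j \<noteq> 0" "\<And>i. i < k \<Longrightarrow> (\<Sum>j<n. W i j * v j) = 0"
    using exists_nontrivial_solution[of "{..<k}" "{..<n}" W] \<open>k < n\<close> by auto
  \<comment> \<open>The values of \<open>v\<close> from \<open>n\<close> on are arbitrary, whereas a
    point of \<open>Euclidean_space n\<close> must vanish there.\<close>
  define x :: "nat \<Rightarrow> real" where "x = (\<lambda>j. if j < n then v j else 0)"
  have "(\<Sum>j<n. W i j * x j) = 0" if "i < k" for i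
    using v(2)[OF that] by (simp add: x_def)
  \<comment> \<open>At both points every coordinate \<open>i < k\<close> equals
    \<open>\<sigma> (b i)\<close>.\<close>
  then have "dense_layer n k \<sigma> W b x = dense_layer n k \<sigma> W b (\<lambda>_. 0)"
    by (auto simp: dense_layer_def)
  then have "Net x = Net (\<lambda>_. 0)"
    by (simp add: assms)
  moreover have "x \<noteq> (\<lambda>_. 0)"
    using v(1) by (metis x_def)
  moreover have "x \<in> topspace (Euclidean_space n)" "(\<lambda>_. 0) \<in> topspace (Euclidean_space n)"
    by (auto simp: x_def topspace_Euclidean_space)
  ultimately show ?thesis
    using not_separating_if_not_injective[OF Hausdorff_Euclidean_space] by blast
qed

end
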